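(* For every integer $k\geq 1$ there is a polynomial $S_k(n)$ in $n$ of degree $4k$ with rational coefficients such that \[ \pi=\sum_{n=0}^\infty \frac{S_k(n)}{\binom{8kn}{4kn}(-4)^{kn}}. \] *)

theory Defs
  imports "HOL-Analysis.Analysis" "HOL-Computational_Algebra.Polynomial"
begin

end

theory Submission
  imports Defs "HOL-Real_Asymp.Real_Asymp"
begin

text \<open>
  Write \<open>N = 4k\<close>, \<open>\<lambda> = 1 + \<i>\<close>, \<open>\<kappa> = 1 - 4\<lambda>\<close> and \<open>\<beta> m\<close> for the integral of \<open>(x(1 - x))\<^sup>m\<close> over \<open>[0,1]\<close>,
  which equals \<open>1 / ((2m + 1) (2m choose m))\<close>. Since \<open>\<lambda> - x(1 - x) = (x - \<i>)(x - 1 + \<i>)\<close>, integrating the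
  geometric series of \<open>(4 + 2\<i>) / (\<lambda> - x(1 - x))\<close> gives \<open>\<pi> = Re (\<Sum>m. (4 + 2\<i>) \<lambda>\<^bsup>-m-1\<^esup> \<beta> m)\<close>.

  The polynomial \<open>G(x) = \<Sum>i<N. g i (x gchoose i)\<close> with \<open>g 0 = 2\<close>, \<open>(2i + 3) g (i + 1) = -2(i + 1) \<kappa> g i\<close> satisfies
  \<open>(2x + 1) G(x) - 8\<lambda>x G(x - 1) = 2 - (2N + 1) g N (x gchoose N)\<close>. At \<open>x = m + 1/2\<close> this expresses
  \<open>\<lambda>\<^bsup>-m-1\<^esup> \<beta> m\<close> as a telescoping difference plus a multiple of \<open>\<lambda>\<^bsup>-m-1\<^esup> \<beta> m (m + 1/2 gchoose N)\<close>. In the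
  latter the binomial cancels the denominators of \<open>\<beta> (Nn + j) (2Nn choose Nn)\<close> for all \<open>j < N\<close>, so grouping
  the terms in blocks of length \<open>N\<close> leaves \<open>\<pi> = q + \<Sum>n. P(n) / ((2Nn choose Nn) (-4)\<^bsup>kn\<^esup>)\<close> with \<open>P\<close> of degree less
  than \<open>N\<close> and a rational constant \<open>q\<close>.

  A second telescoping sum writes every nonzero rational as such a series with a polynomial of degree
  exactly \<open>N\<close>, so only \<open>q \<noteq> 0\<close> is left. From \<open>G(-1/2) = 2 (\<Sum>j<N. \<kappa>\<^sup>j / (2j + 1))\<close> one finds that \<open>q\<close> is \<open>-16\<close> times
  the sum of \<open>Re ((1 + \<i>/2) \<kappa>\<^sup>j) / (2j + 1)\<close> over \<open>j < N\<close>. Expanding in binomial coefficients \<open>N choose (i + 1)\<close>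
  shows that the 2-adic valuation of this sum is that of \<open>N\<close>.
\<close>

subsection \<open>Inverse central binomial coefficients\<close>

definition ibc :: "nat \<Rightarrow> real" where
  "ibc m = 1 / real ((2 * m) choose m)"

lemma ibc_0 [simp]: "ibc 0 = 1"
  by (simp add: ibc_def)

lemma ibc_pos: "ibc m > 0"
  by (simp add: ibc_def)

lemma ibc_fact: "ibc m = fact m ^ 2 / fact (2 * m)"
proof -
  have "real ((2 * m) choose m) = fact (2 * m) / (fact m * fact (2 * m - m))"
    by (rule binomial_fact) simp
  then show ?thesis
    by (simp add: ibc_def power2_eq_square mult_2)
qed

lemma ibc_Suc: "ibc (Suc m) = ibc m * (real m + 1) / (2 * (2 * real m + 1))"
proof -
  have "fact (2 * Suc m) = (2 * real m + 2) * (2 * real m + 1) * fact (2 * m)"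
    by (simp add: algebra_simps)
  moreover have "(fact (Suc m) :: real) = (real m + 1) * fact m"
    by (simp add: algebra_simps)
  ultimately have "ibc (Suc m) = ((real m + 1) * fact m) ^ 2 /
      ((2 * real m + 2) * (2 * real m + 1) * fact (2 * m))"
    unfolding ibc_fact by (simp only:)
  also have "\<dots> = ibc m * (real m + 1) / (2 * (2 * real m + 1))"
    unfolding ibc_fact by (simp add: divide_simps power2_eq_square) (simp add: algebra_simps)
  finally show ?thesis .
qed

lemma ibc_le: "ibc m \<le> (1 / 2) ^ m"
proof (induction m)
  case (Suc m)
  have "ibc (Suc m) = ibc m * ((real m + 1) / (2 * (2 * real m + 1)))"
    by (simp add: ibc_Suc)
  also have "\<dots> \<le> (1 / 2) ^ m * (1 / 2)"
    using Suc ibc_pos[of m] by (intro mult_mono) (auto simp: field_simps)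
  finally show ?case by simp
qed simp

text \<open>This iterates \<open>ibc_Suc\<close>, with the odd denominators kept on the left so that
  they can later be cancelled as a block.\<close>

lemma ibc_add:
  "ibc (u + j) * (2 ^ j * (\<Prod>i<j. 2 * real u + 2 * real i + 1)) =
     ibc u * (\<Prod>i\<in>{1..j}. real u + real i)"
proof (induction j)
  case (Suc j)
  have "ibc (u + Suc j) * (2 * (2 * real u + 2 * real j + 1)) = ibc (u + j) * (real u + real j + 1)"
    by (simp add: ibc_Suc add_divide_distrib)
  moreover have "ibc (u + Suc j) * (2 ^ Suc j * (\<Prod>i<Suc j. 2 * real u + 2 * real i + 1)) =
      ibc (u + Suc j) * (2 * (2 * real u + 2 * real j + 1)) * (2 ^ j * (\<Prod>i<j. 2 * real u + 2 * real i + 1))"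
    by (simp only: power_Suc prod.lessThan_Suc mult_ac)
  ultimately have "ibc (u + Suc j) * (2 ^ Suc j * (\<Prod>i<Suc j. 2 * real u + 2 * real i + 1)) =
      (ibc (u + j) * (real u + real j + 1)) * (2 ^ j * (\<Prod>i<j. 2 * real u + 2 * real i + 1))"
    by (simp only:)
  also have "\<dots> = ibc u * (\<Prod>i\<in>{1..Suc j}. real u + real i)"
    using Suc by (simp add: algebra_simps)
  finally show ?case .
qed simp

lemma poly_times_ibc_tendsto_0:
  fixes p :: "real poly"
  assumes "K \<ge> 1"
  shows "(\<lambda>n. poly p (real n) * ibc (K * n)) \<longlonglongrightarrow> 0"
proof (rule Lim_null_comparison)
  have "ibc (K * n) \<le> (1 / 2) ^ n" for n
  proof -
    have "ibc (K * n) \<le> (1 / 2) ^ (K * n)" by (rule ibc_le)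
    also have "\<dots> \<le> (1 / 2) ^ n" using assms by (intro power_decreasing) auto
    finally show ?thesis .
  qed
  then show "\<forall>\<^sub>F n in sequentially. norm (poly p (real n) * ibc (K * n)) \<le> \<bar>poly p (real n) * (1 / 2) ^ n\<bar>"
    by (auto intro!: always_eventually mult_left_mono simp: abs_mult less_imp_le[OF ibc_pos])
  have "(\<lambda>n. real n ^ i * (1 / 2) ^ n) \<longlonglongrightarrow> 0" for i
    by real_asymp
  then have "(\<lambda>n. \<Sum>i\<le>degree p. coeff p i * (real n ^ i * (1 / 2) ^ n)) \<longlonglongrightarrow> 0"
    by (intro tendsto_null_sum tendsto_mult_right_zero)
  then have "(\<lambda>n. poly p (real n) * (1 / 2) ^ n) \<longlonglongrightarrow> 0"
    by (simp add: poly_altdef sum_distrib_right mult.assoc)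
  then show "(\<lambda>n. \<bar>poly p (real n) * (1 / 2) ^ n\<bar>) \<longlonglongrightarrow> 0"
    by (rule tendsto_rabs_zero)
qed

lemma has_integral_power_times_compl:
  "((\<lambda>x. (x * (1 - x)) ^ m) has_integral ibc m / (2 * real m + 1)) {0..1::real}"
proof -
  have "((\<lambda>t. t powr (real (Suc m) - 1) * (1 - t) powr (real (Suc m) - 1)) has_integral
      Beta (real (Suc m)) (real (Suc m))) {0..1}"
    by (rule has_integral_Beta_real) auto
  moreover have "Beta (real (Suc m)) (real (Suc m)) = ibc m / (2 * real m + 1)"
  proof -
    have "Gamma (real (Suc m)) = fact m" "Gamma (real (Suc m) + real (Suc m)) = (2 * real m + 1) * fact (2 * m)"
      using Gamma_fact[of m, where ?'a = real] Gamma_fact[of "2 * m + 1", where ?'a = real] by (simp_all add: algebra_simps)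
    then show ?thesis by (simp add: Beta_def ibc_fact power2_eq_square)
  qed
  ultimately have *: "((\<lambda>t. t powr (real (Suc m) - 1) * (1 - t) powr (real (Suc m) - 1)) has_integral
      ibc m / (2 * real m + 1)) {0..1}" by simp
  \<comment> \<open>The integrands may differ at the endpoints: for \<open>m = 0\<close>,
    \<open>0 powr 0 = 0\<close> but \<open>0 ^ 0 = 1\<close>.\<close>
  show ?thesis
    by (rule has_integral_spike_finite[OF _ _ *, of "{0, 1}"])
      (auto simp: powr_realpow power_mult_distrib)
qed

subsection \<open>A series for pi\<close>

definition lam :: complex where "lam = 1 + \<i>"

lemma lam_neq_0 [simp]: "lam \<noteq> 0" by (simp add: lam_def complex_eq_iff)

text \<open>The source of the factor \<open>(-4) ^ (k * n)\<close>: advancing \<open>m\<close> by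
  \<open>4 * k\<close> multiplies \<open>lam ^ m\<close> by \<open>(-4) ^ k\<close>.\<close>

lemma lam_pow4: "lam ^ 4 = -4"
  by (simp add: lam_def power4_eq_xxxx complex_eq_iff)

lemma norm_lam: "norm lam = sqrt 2"
  by (simp add: lam_def cmod_def)

lemma Re_geometric:
  fixes x :: real
  shows "Re ((4 + 2 * \<i>) / (lam - of_real (x * (1 - x)))) = 2 / (1 + x\<^sup>2) + 2 / (1 + (x - 1)\<^sup>2)"
proof -
  define u v where "u = of_real x - \<i>" and "v = of_real x - 1 + \<i>"
  have uv: "lam - of_real (x * (1 - x)) = u * v"
    by (simp add: lam_def u_def v_def complex_eq_iff algebra_simps)
  have nz: "u \<noteq> 0" "v \<noteq> 0" by (auto simp: u_def v_def complex_eq_iff)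
  \<comment> \<open>Since \<open>v - u = 2 * \<i> - 1\<close>, the numerator is
    \<open>-2 * \<i> * (v - u)\<close>. Hence the real part is twice the imaginary part of
    \<open>1 / u - 1 / v\<close>, a sum of two arctangent derivatives.\<close>
  have "(4 + 2 * \<i>) / (u * v) = -2 * \<i> * (1 / u - 1 / v)"
    using nz by (simp add: divide_simps) (simp add: u_def v_def complex_eq_iff)
  moreover have "Im (1 / u) = 1 / (1 + x\<^sup>2)" "Im (1 / v) = - (1 / (1 + (x - 1)\<^sup>2))"
    by (simp_all add: u_def v_def Im_divide power2_eq_square add.commute)
  ultimately show ?thesis unfolding uv by simp
qed

text \<open>The geometric series converges uniformly on [0,1], as \<open>norm lam = sqrt 2\<close>
  exceeds the maximum 1/4 of \<open>x * (1 - x)\<close>, so it may be integrated term by term. Each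
  of the two arctangents contributes \<open>pi / 2\<close>.\<close>

lemma pi_series:
  "(\<lambda>m. Re ((4 + 2 * \<i>) / lam ^ Suc m) * (ibc m / (2 * real m + 1))) sums pi"
proof -
  define f where "f = (\<lambda>m (x::real). Re ((4 + 2 * \<i>) / lam ^ Suc m) * (x * (1 - x)) ^ m)"
  define F where "F = (\<lambda>x::real. 2 / (1 + x\<^sup>2) + 2 / (1 + (x - 1)\<^sup>2))"
  have bound: "norm (of_real (x * (1 - x)) / lam) \<le> 1 / 2" if "x \<in> {0..1}" for x :: real
  proof -
    have "0 \<le> x * (1 - x)" using that by simp
    moreover have "x * (1 - x) \<le> 1 / 4" 
      using zero_le_power2[of "x - 1/2"] by (simp add: power2_eq_square algebra_simps)
    ultimately have "\<bar>x * (1 - x)\<bar> / sqrt 2 \<le> (1 / 4) / 1"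
      by (intro frac_le) auto
    then show ?thesis by (simp only: norm_divide norm_lam norm_of_real)
  qed
  have eq: "f m x = Re ((4 + 2 * \<i>) / lam * (of_real (x * (1 - x)) / lam) ^ m)" for m x
  proof -
    have "(4 + 2 * \<i>) / lam * (of_real (x * (1 - x)) / lam) ^ m =
        ((4 + 2 * \<i>) / lam ^ Suc m) * of_real ((x * (1 - x)) ^ m)"
      by (simp add: power_divide power_mult_distrib)
    then show ?thesis unfolding f_def by (simp only: times_complex.sel Re_complex_of_real Im_complex_of_real)
  qed
  have lim: "uniform_limit {0..1} (\<lambda>n x. \<Sum>m<n. f m x) (\<lambda>x. suminf (\<lambda>m. f m x)) sequentially"
  proof (rule Weierstrass_m_test)
    show "norm (f m x) \<le> norm ((4 + 2 * \<i>) / lam) * (1 / 2) ^ m" if "x \<in> {0..1}" for m x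
    proof -
      have "norm (f m x) \<le> norm ((4 + 2 * \<i>) / lam * (of_real (x * (1 - x)) / lam) ^ m)"
        unfolding eq real_norm_def by (rule abs_Re_le_cmod)
      also have "\<dots> \<le> norm ((4 + 2 * \<i>) / lam) * (1 / 2) ^ m"
        unfolding norm_mult norm_power by (intro mult_left_mono power_mono bound that) auto
      finally show ?thesis .
    qed
    show "summable (\<lambda>m. norm ((4 + 2 * \<i>) / lam) * (1 / 2) ^ m)"
      by (intro summable_mult summable_geometric) auto
  qed
  have sum: "suminf (\<lambda>m. f m x) = F x" if "x \<in> {0..1}" for x
  proof -
    have "(\<lambda>m. (of_real (x * (1 - x)) / lam) ^ m) sums (1 / (1 - of_real (x * (1 - x)) / lam))"
      using bound[OF that] by (intro geometric_sums) auto
    from sums_Re[OF sums_mult[OF this, of "(4 + 2 * \<i>) / lam"]]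
    have "(\<lambda>m. f m x) sums Re ((4 + 2 * \<i>) / lam * (1 / (1 - of_real (x * (1 - x)) / lam)))"
      by (simp only: eq)
    also have "(4 + 2 * \<i>) / lam * (1 / (1 - of_real (x * (1 - x)) / lam)) = (4 + 2 * \<i>) / (lam - of_real (x * (1 - x)))"
      by (simp add: divide_simps)
    finally show ?thesis unfolding F_def Re_geometric by (rule sums_unique[symmetric])
  qed
  have "(F has_integral ((2 * arctan 1 + 2 * arctan (1 - 1)) - (2 * arctan 0 + 2 * arctan (0 - 1)))) {0..1}"
    unfolding F_def
    by (rule fundamental_theorem_of_calculus)
      (auto intro!: derivative_eq_intros simp: has_real_derivative_iff_has_vector_derivative[symmetric] divide_inverse)
  then have F: "(F has_integral pi) {0..1}" by (simp add: arctan_minus arctan_one)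
  have "((\<lambda>n. integral {0..1} (\<lambda>x. \<Sum>m<n. f m x)) \<longlongrightarrow> integral {0..1} F) sequentially"
  proof -
    have "uniform_limit {0..1} (\<lambda>n x. \<Sum>m<n. f m x) F sequentially"
      using lim sum by (subst (asm) uniform_limit_cong'[where i = F]) auto
    then obtain I J where IJ: "\<And>n. ((\<lambda>x. \<Sum>m<n. f m x) has_integral I n) {0..1}" "(F has_integral J) {0..1}" "(I \<longlongrightarrow> J) sequentially"
      by (rule uniform_limit_integral) (auto simp: f_def intro!: continuous_intros)
    have "I = (\<lambda>n. integral {0..1} (\<lambda>x. \<Sum>m<n. f m x))" "J = integral {0..1} F"
      using integral_unique[OF IJ(1)] integral_unique[OF IJ(2)] by auto
    with IJ(3) show ?thesis by simp
  qed
  moreover have "integral {0..1} (\<lambda>x. \<Sum>m<n. f m x) = 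
      (\<Sum>m<n. Re ((4 + 2 * \<i>) / lam ^ Suc m) * (ibc m / (2 * real m + 1)))" for n
    unfolding f_def
    by (intro integral_unique has_integral_sum has_integral_mult_right has_integral_power_times_compl) auto
  ultimately show ?thesis using F by (simp add: sums_def integral_unique)
qed

subsection \<open>The 2-adic valuation of the constant term\<close>

text \<open>The integers localized at the prime 2, placed inside the reals; membership of a rational
  means nonnegative 2-adic valuation.\<close>

definition odd_denom :: "real set" where
  "odd_denom = {real_of_int a / real_of_int b | a b. odd b}"

lemma odd_denom_of_int [intro, simp]: "of_int a \<in> odd_denom"
  unfolding odd_denom_def by (rule CollectI, rule exI[of _ a], rule exI[of _ 1]) simp

lemma odd_denom_of_nat [intro, simp]: "of_nat a \<in> odd_denom"
  using odd_denom_of_int[of "int a"] by simp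

lemma odd_denom_mult [intro]: "x \<in> odd_denom \<Longrightarrow> y \<in> odd_denom \<Longrightarrow> x * y \<in> odd_denom"
proof -
  assume "x \<in> odd_denom" "y \<in> odd_denom"
  then obtain a b c d where "x = of_int a / of_int b" "odd b" "y = of_int c / of_int d" "odd d"
    by (auto simp: odd_denom_def)
  then have "x * y = of_int (a * c) / of_int (b * d) \<and> odd (b * d)" by simp
  then show ?thesis unfolding odd_denom_def by blast
qed

lemma odd_denom_diff [intro]: "x \<in> odd_denom \<Longrightarrow> y \<in> odd_denom \<Longrightarrow> x - y \<in> odd_denom"
proof -
  assume "x \<in> odd_denom" "y \<in> odd_denom"
  then obtain a b c d where *: "x = of_int a / of_int b" "odd b" "y = of_int c / of_int d" "odd d"
    by (auto simp: odd_denom_def)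
  then have "b \<noteq> 0" "d \<noteq> 0" by auto
  with * have "x - y = of_int (a * d - c * b) / of_int (b * d) \<and> odd (b * d)"
    by (simp add: diff_frac_eq)
  then show ?thesis unfolding odd_denom_def by blast
qed

lemma odd_denom_add [intro]: "x \<in> odd_denom \<Longrightarrow> y \<in> odd_denom \<Longrightarrow> x + y \<in> odd_denom"
  using odd_denom_diff[of x "0 - y"] odd_denom_diff[of 0 y] odd_denom_of_int[of 0] by simp

lemma odd_denom_sum: "(\<And>i. i \<in> I \<Longrightarrow> f i \<in> odd_denom) \<Longrightarrow> sum f I \<in> odd_denom"
  using odd_denom_of_int[of 0] by (induction I rule: infinite_finite_induct) auto

lemma odd_denom_divide: "x \<in> odd_denom \<Longrightarrow> odd n \<Longrightarrow> x / real n \<in> odd_denom"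
proof -
  assume "x \<in> odd_denom" "odd n"
  then have "1 / real n \<in> odd_denom"
    unfolding odd_denom_def by (intro CollectI exI[of _ 1] exI[of _ "int n"]) auto
  from odd_denom_mult[OF \<open>x \<in> odd_denom\<close> this] show ?thesis by simp
qed

lemma odd_denom_imp_Rats: "x \<in> odd_denom \<Longrightarrow> x \<in> \<rat>"
  by (auto simp: odd_denom_def)

text \<open>Over an odd denominator \<open>b\<close> the numerator \<open>b + 2 * a\<close> is odd,
  hence nonzero.\<close>

lemma odd_denom_one_plus_double_neq_0:
  assumes "x \<in> odd_denom"
  shows "1 + 2 * x \<noteq> 0"
proof
  assume eq: "1 + 2 * x = 0"
  from assms obtain a b where ab: "x = of_int a / of_int b" "odd b" by (auto simp: odd_denom_def)
  then have "b \<noteq> 0" by auto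
  with eq ab have "real_of_int (b + 2 * a) = 0" by (simp add: field_simps)
  then have "b = 2 * (- a)" by linarith
  with \<open>odd b\<close> show False by simp
qed

text \<open>If \<open>2 ^ a\<close> is the power of 2 in \<open>n + 1\<close>, then
  \<open>2 ^ a \<le> n + 1 < 2 ^ n\<close> forces \<open>a \<le> n - 1\<close>. At
  \<open>n = 1\<close> the quotient is 1/2, so \<open>artanh_partial_sum\<close> treats that case
  separately.\<close>

lemma power2_div_odd_denom:
  assumes "n \<ge> 2"
  shows "2 ^ (n - 1) / real (n + 1) \<in> odd_denom"
proof -
  obtain a b where ab: "n + 1 = 2 ^ a * b" "odd b"
    using multiplicity_decompose'[of "n + 1" 2] by (metis (no_types, lifting) Suc_eq_plus1 nat.distinct(1) not_prime_unit odd_one)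
  have less: "m + 1 < 2 ^ m" if "m \<ge> 2" for m :: nat
    using that by (induction m rule: dec_induct) auto
  have "2 ^ a \<le> n + 1" using ab by (cases b) auto
  also have "\<dots> < 2 ^ n" using less[OF assms] .
  finally have "a < n" by simp
  then have "(2::real) ^ (n - 1) = 2 ^ a * 2 ^ (n - 1 - a)" by (simp flip: power_add)
  then have "2 ^ (n - 1) / real (n + 1) = real (2 ^ (n - 1 - a)) / real b"
    unfolding ab(1) by simp
  also have "\<dots> \<in> odd_denom" by (rule odd_denom_divide[OF odd_denom_of_nat ab(2)])
  finally show ?thesis .
qed

text \<open>Division by \<open>2 * j + 1\<close> on the level of Newton coefficients: by
  \<open>absorb\<close>, multiplication by \<open>j\<close> turns \<open>j choose i\<close> into a
  combination of \<open>j choose i\<close> and \<open>j choose Suc i\<close>, which yields the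
  two-term recurrence.\<close>

lemma binomial_transform_recurrence:
  fixes c d :: "nat \<Rightarrow> real"
  assumes "c 0 = d 0" and "\<And>i. (2 * real (Suc i) + 1) * c (Suc i) + 2 * real (Suc i) * c i = d (Suc i)"
  shows "(2 * real j + 1) * (\<Sum>i\<le>j. real (j choose i) * c i) = (\<Sum>i\<le>j. real (j choose i) * d i)"
proof -
  \<comment> \<open>\<open>b\<close> is \<open>c\<close> shifted by one place and padded with 0,
    which merges both hypotheses into the single formula \<open>d\<close>.\<close>
  define b where "b = (\<lambda>i. case i of 0 \<Rightarrow> 0 | Suc i \<Rightarrow> c i)"
  have d: "d i = (2 * real i + 1) * c i + 2 * real i * b i" for i
    using assms by (cases i) (simp_all add: b_def)
  have absorb: "real j * real (j choose i) = real i * real (j choose i) + real (Suc i) * real (j choose Suc i)" for i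
    using gbinomial_mult_1[of "real j" i] by (simp flip: binomial_gbinomial)
  have "(2 * real j + 1) * (\<Sum>i\<le>j. real (j choose i) * c i) =
      (\<Sum>i\<le>j. real (j choose i) * c i + 2 * (real j * real (j choose i)) * c i)"
    by (simp add: sum_distrib_left algebra_simps)
  also have "\<dots> = (\<Sum>i\<le>j. real (j choose i) * ((2 * real i + 1) * c i)) +
      (\<Sum>i\<le>j. 2 * real (Suc i) * real (j choose Suc i) * b (Suc i))"
    unfolding absorb by (simp add: b_def sum.distrib[symmetric] algebra_simps)
  also have "(\<Sum>i\<le>j. 2 * real (Suc i) * real (j choose Suc i) * b (Suc i)) =
      (\<Sum>i\<le>Suc j. 2 * real i * real (j choose i) * b i)"
    by (subst sum.atMost_Suc_shift) simp
  also have "\<dots> = (\<Sum>i\<le>j. real (j choose i) * (2 * real i * b i))"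
    by (simp add: mult_ac)
  finally show ?thesis by (simp add: d sum.distrib[symmetric] algebra_simps)
qed

text \<open>The hockey-stick identity for each coefficient \<open>c i\<close>, with Pascal's rule as
  the induction step.\<close>

lemma sum_binomial_transform:
  fixes c :: "nat \<Rightarrow> real"
  shows "(\<Sum>j<n. \<Sum>i\<le>j. real (j choose i) * c i) = (\<Sum>i<n. real (n choose Suc i) * c i)"
proof (induction n)
  case (Suc n)
  have "(\<Sum>i<Suc n. real (Suc n choose Suc i) * c i) =
      (\<Sum>i<Suc n. real (n choose i) * c i) + (\<Sum>i<Suc n. real (n choose Suc i) * c i)"
    by (simp only: binomial_Suc_Suc of_nat_add distrib_right sum.distrib)
  then show ?case using Suc by (simp add: lessThan_Suc_atMost[symmetric] del: binomial_Suc_Suc)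
qed simp

text \<open>Powers of \<open>-2 * lam\<close> keep an even imaginary part, which absorbs the 2 in
  \<open>\<i> / 2\<close>; the value is in fact an integer.\<close>

lemma Re_power_odd_denom: "Re ((1 + \<i> / 2) * (- 2 * lam) ^ i) \<in> odd_denom"
proof -
  have "\<exists>a b :: int. (- 2 * lam) ^ i = Complex (of_int a) (of_int (2 * b))"
  proof (induction i)
    case 0
    show ?case by (rule exI[of _ 1], rule exI[of _ 0]) (simp add: complex_eq_iff)
  next
    case (Suc i)
    then obtain a b :: int where "(- 2 * lam) ^ i = Complex (of_int a) (of_int (2 * b))" by blast
    then have "(- 2 * lam) ^ Suc i = Complex (of_int (4 * b - 2 * a)) (of_int (2 * (- a - 2 * b)))"
      by (simp add: lam_def complex_eq_iff)
    then show ?case by blast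
  qed
  then obtain a b :: int where "(- 2 * lam) ^ i = Complex (of_int a) (of_int (2 * b))" by blast
  then have "Re ((1 + \<i> / 2) * (- 2 * lam) ^ i) = of_int (a - b)" by simp
  then show ?thesis by (simp only: odd_denom_of_int)
qed

text \<open>
  \<open>2\<^sup>i gam i\<close> is the \<open>i\<close>-th forward difference at 0 of \<open>j \<mapsto> Re ((1 + \<i>/2) \<kappa>\<^sup>j) / (2j + 1)\<close>.
\<close>

primrec gam :: "nat \<Rightarrow> real" where
  "gam 0 = 1"
| "gam (Suc i) = (Re ((1 + \<i> / 2) * (- 2 * lam) ^ Suc i) - real (Suc i) * gam i) / real (2 * i + 3)"

lemma gam_odd_denom: "gam i \<in> odd_denom"
proof (induction i)
  case (Suc i)
  then show ?case
    unfolding gam.simps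
    by (intro odd_denom_divide odd_denom_diff odd_denom_mult Re_power_odd_denom odd_denom_of_nat) auto
qed (use odd_denom_of_int[of 1] in simp)

definition kap :: complex where "kap = 1 - 4 * lam"

text \<open>Expand \<open>kap = 1 + 2 * (-2 * lam)\<close> binomially and divide by
  \<open>2 * j + 1\<close>; the recursion for \<open>gam\<close> is the resulting relation with the
  powers of 2 removed.\<close>

lemma Re_kap_power:
  "Re ((1 + \<i> / 2) * kap ^ j) / (2 * real j + 1) = (\<Sum>i\<le>j. real (j choose i) * (2 ^ i * gam i))"
proof -
  have "(2 * real j + 1) * (\<Sum>i\<le>j. real (j choose i) * (2 ^ i * gam i)) =
      (\<Sum>i\<le>j. real (j choose i) * (2 ^ i * Re ((1 + \<i> / 2) * (- 2 * lam) ^ i)))"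
  proof (rule binomial_transform_recurrence)
    show "(2 * real (Suc i) + 1) * (2 ^ Suc i * gam (Suc i)) + 2 * real (Suc i) * (2 ^ i * gam i) =
      2 ^ Suc i * Re ((1 + \<i> / 2) * (- 2 * lam) ^ Suc i)" for i
    proof -
      define R where "R = Re ((1 + \<i> / 2) * (- 2 * lam) ^ Suc i)"
      have "(2 * real (Suc i) + 1) * gam (Suc i) = R - real (Suc i) * gam i"
        unfolding gam.simps R_def[symmetric] by (simp add: add.commute)
      then have "2 ^ Suc i * ((2 * real (Suc i) + 1) * gam (Suc i)) = 2 ^ Suc i * (R - real (Suc i) * gam i)"
        by (simp only:)
      then show ?thesis unfolding R_def[symmetric] by (simp add: algebra_simps del: gam.simps)
    qed
  qed simp
  also have "\<dots> = Re ((1 + \<i> / 2) * (\<Sum>i\<le>j. of_nat (j choose i) * (- 4 * lam) ^ i))"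
  proof -
    have "real (j choose i) * (2 ^ i * Re ((1 + \<i> / 2) * (- 2 * lam) ^ i)) =
        Re ((1 + \<i> / 2) * (of_nat (j choose i) * (- 4 * lam) ^ i))" for i
    proof -
      have "(- 4 * lam) ^ i = of_real (2 ^ i) * (- 2 * lam) ^ i"
        by (simp flip: power_mult_distrib)
      then have "(1 + \<i> / 2) * (of_nat (j choose i) * (- 4 * lam) ^ i) =
          of_real (real (j choose i) * 2 ^ i) * ((1 + \<i> / 2) * (- 2 * lam) ^ i)"
        by (simp add: mult_ac)
      then show ?thesis by (simp only: Re_complex_of_real Im_complex_of_real times_complex.sel)
    qed
    then show ?thesis by (simp only: sum_distrib_left Re_sum)
  qed
  also have "(\<Sum>i\<le>j. of_nat (j choose i) * (- 4 * lam) ^ i) = kap ^ j"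
    using binomial_ring[of "- 4 * lam" 1 j] by (simp add: kap_def)
  finally show ?thesis by (simp add: field_simps)
qed

text \<open>As \<open>kap = (1 - 2 * \<i>) ^ 2\<close> and
  \<open>1 + \<i> / 2 = (\<i> / 2) * (1 - 2 * \<i>)\<close>, \<open>Z\<close> is minus half the
  imaginary part of a truncated formal artanh series at \<open>1 - 2 * \<i>\<close>. It does not
  vanish because it is \<open>n\<close> times a number of the form \<open>1 + 2 * s\<close> with
  \<open>s\<close> in \<open>odd_denom\<close>.\<close>

lemma artanh_partial_sum:
  assumes "n \<ge> 1"
  defines "Z \<equiv> \<Sum>j<n. Re ((1 + \<i> / 2) * kap ^ j) / (2 * real j + 1)"
  shows "Z \<noteq> 0" and "Z \<in> \<rat>"
proof -
  obtain m where n: "n = Suc m" using assms by (cases n) auto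
  define z where "z = (\<lambda>i. real (m choose Suc i) * (2 ^ i / real (Suc i + 1) * gam (Suc i)))"
  have z: "z i \<in> odd_denom" for i
  proof -
    have "2 ^ i / real (Suc i + 1) * gam (Suc i) \<in> odd_denom"
    proof (cases i)
      case 0
      \<comment> \<open>Here the first factor is 1/2, compensated by the even numerator of
        \<open>gam 1 = -2/3\<close>.\<close>
      have "Re ((1 + \<i> / 2) * (- 2 * lam)) = -1" by (simp add: lam_def)
      then have "2 ^ i / real (Suc i + 1) * gam (Suc i) = of_int (- 1) / real 3" using 0 by simp
      also have "\<dots> \<in> odd_denom" by (intro odd_denom_divide odd_denom_of_int) auto
      finally show ?thesis .
    next
      case (Suc l)
      then show ?thesis using power2_div_odd_denom[of "Suc i"] by (intro odd_denom_mult gam_odd_denom) simp_all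
    qed
    then show ?thesis unfolding z_def by (rule odd_denom_mult[OF odd_denom_of_nat])
  qed
  have "Z = (\<Sum>i<n. real (n choose Suc i) * (2 ^ i * gam i))"
    unfolding Z_def Re_kap_power by (rule sum_binomial_transform)
  \<comment> \<open>Absorption turns \<open>n choose Suc i\<close> into \<open>n / Suc i\<close>
    times \<open>m choose i\<close>, which pulls out \<open>n\<close>; of the remaining terms all
    but the one for \<open>i = 0\<close> carry a factor 2.\<close>
  also have "\<dots> = (\<Sum>i<n. real n * (real (m choose i) * (2 ^ i / real (Suc i) * gam i)))"
  proof (rule sum.cong)
    fix i
    have "real (Suc i) * real (n choose Suc i) = real n * real (m choose i)"
      unfolding n by (metis of_nat_mult Suc_times_binomial mult.commute)
    then have "real (n choose Suc i) = real n * real (m choose i) / real (Suc i)"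
      by (simp add: field_simps del: of_nat_Suc)
    then show "real (n choose Suc i) * (2 ^ i * gam i) = real n * (real (m choose i) * (2 ^ i / real (Suc i) * gam i))"
      by simp
  qed simp
  also have "\<dots> = real n * (1 + 2 * (\<Sum>i<m. z i))"
  proof -
    have "(\<Sum>i<n. real (m choose i) * (2 ^ i / real (Suc i) * gam i)) = 1 + (\<Sum>i<m. 2 * z i)"
      unfolding n by (subst sum.lessThan_Suc_shift) (simp add: z_def mult_ac del: gam.simps(2))
    then show ?thesis by (simp only: sum_distrib_left[symmetric])
  qed
  finally have Z: "Z = real n * (1 + 2 * (\<Sum>i<m. z i))" .
  have zs: "(\<Sum>i<m. z i) \<in> odd_denom" by (intro odd_denom_sum z)
  show "Z \<noteq> 0" unfolding Z using odd_denom_one_plus_double_neq_0[OF zs] n by simp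
  show "Z \<in> \<rat>" unfolding Z using odd_denom_imp_Rats[OF zs] by (intro Rats_mult Rats_add) auto
qed

subsection \<open>The telescoping certificate\<close>

text \<open>These are the \<open>g i\<close> of the overview, and \<open>cert\<close> is its
  \<open>G\<close>. The ratio is the one for which the coefficients of \<open>x gchoose i\<close>
  with \<open>0 < i < N\<close> cancel in \<open>cert_recurrence\<close>.\<close>

primrec newton :: "nat \<Rightarrow> complex" where
  "newton 0 = 2"
| "newton (Suc i) = - kap * of_real (2 * real (Suc i) / (2 * real i + 3)) * newton i"

definition cert :: "nat \<Rightarrow> real \<Rightarrow> complex" where
  "cert N x = (\<Sum>i<N. newton i * of_real (x gchoose i))"

lemma newton_Suc_mult: "(2 * of_nat i + 3) * newton (Suc i) = - 2 * of_nat (Suc i) * kap * newton i"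
proof -
  have "(2 * of_nat i + 3 :: complex) = of_real (2 * real i + 3)" by simp
  moreover have "of_real (2 * real i + 3) * of_real (2 * real (Suc i) / (2 * real i + 3)) = (of_real (2 * real (Suc i)) :: complex)"
    unfolding of_real_mult[symmetric] by (rule arg_cong[of _ _ of_real]) (simp add: field_simps)
  ultimately show ?thesis by (simp add: mult_ac del: of_nat_Suc of_real_divide of_real_add)
qed

lemma cert_recurrence:
  "of_real (2 * x + 1) * cert N x - 8 * lam * of_real x * cert N (x - 1) =
     2 - of_nat (2 * N + 1) * newton N * of_real (x gchoose N)"
proof (induction N)
  case 0
  then show ?case by (simp add: cert_def)
next
  case (Suc N)
  define a b where "a = (of_real (x gchoose N) :: complex)" and "b = (of_real (real (Suc N) * (x gchoose Suc N)) :: complex)"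
  have 1: "of_real x * a = of_nat N * a + b"
    using arg_cong[OF gbinomial_mult_1[of x N], of complex_of_real] by (simp add: a_def b_def)
  have 2: "of_real x * of_real ((x - 1) gchoose N) = b"
    using arg_cong[OF gbinomial_absorption[of N x], of complex_of_real] by (simp add: b_def)
  have 3: "of_nat (2 * Suc N + 1) * newton (Suc N) * of_real (x gchoose Suc N) = - 2 * kap * newton N * b"
    using arg_cong[OF newton_Suc_mult[of N], of "\<lambda>z. z * of_real (x gchoose Suc N)"]
    by (simp add: b_def algebra_simps del: newton.simps)
  have "of_real (2 * x + 1) * cert (Suc N) x - 8 * lam * of_real x * cert (Suc N) (x - 1) =
      (of_real (2 * x + 1) * cert N x - 8 * lam * of_real x * cert N (x - 1)) +
      newton N * (2 * (of_real x * a) + a - 8 * lam * (of_real x * of_real ((x - 1) gchoose N)))"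
    by (simp add: cert_def a_def algebra_simps)
  also have "\<dots> = 2 - of_nat (2 * N + 1) * newton N * a + newton N * (2 * (of_nat N * a + b) + a - 8 * lam * b)"
    by (simp only: Suc 1 2 a_def[symmetric])
  \<comment> \<open>The terms in \<open>a\<close> cancel, and
    \<open>2 - 8 * lam = 2 * kap\<close>.\<close>
  also have "\<dots> = 2 - (- 2 * kap * newton N * b)"
    by (simp add: kap_def algebra_simps)
  finally show ?case unfolding 3 .
qed

text \<open>Consecutive values of \<open>(-1/2) gchoose i\<close> have ratio
  \<open>-(2 * i + 1) / (2 * i + 2)\<close>; together with the ratio of \<open>newton\<close> this
  gives \<open>kap * (2 * i + 1) / (2 * i + 3)\<close>. The value at -1/2 is the boundary term of
  the telescoping sum.\<close>

lemma cert_minus_half: "cert N (- 1 / 2) = 2 * (\<Sum>i<N. kap ^ i / (2 * of_nat i + 1))"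
proof -
  have "newton i * of_real ((- 1 / 2 :: real) gchoose i) = 2 * (kap ^ i / of_real (2 * real i + 1))" for i
  proof (induction i)
    case (Suc i)
    have "(- 1 / 2 :: real) gchoose Suc i = ((- 1 / 2) gchoose i) * ((- 1 / 2 - real i) / real (Suc i))"
      using gbinomial_mult_1[of "- 1 / 2 :: real" i] by (simp add: field_simps)
    then have "newton (Suc i) * of_real ((- 1 / 2 :: real) gchoose Suc i) =
        - kap * of_real (2 * real (Suc i) / (2 * real i + 3) * ((- 1 / 2 - real i) / real (Suc i))) *
        (newton i * of_real ((- 1 / 2 :: real) gchoose i))"
      by (simp only: newton.simps of_real_mult mult_ac)
    also have "2 * real (Suc i) / (2 * real i + 3) * ((- 1 / 2 - real i) / real (Suc i)) = - ((2 * real i + 1) / (2 * real i + 3))"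
      by (simp add: divide_simps)
    also have "- kap * of_real (- ((2 * real i + 1) / (2 * real i + 3))) * (newton i * of_real ((- 1 / 2 :: real) gchoose i)) =
        2 * kap ^ Suc i * of_real ((2 * real i + 1) / (2 * real i + 3) / (2 * real i + 1))"
    proof -
      have "- kap * of_real (- u) * (2 * (kap ^ i / of_real v)) = 2 * kap ^ Suc i * of_real (u / v)" for u v
        by simp
      then show ?thesis unfolding Suc .
    qed
    also have "(2 * real i + 1) / (2 * real i + 3) / (2 * real i + 1) = 1 / (2 * real (Suc i) + 1)"
      by (simp add: divide_simps)
    finally show ?case by (simp add: mult_ac)
  qed simp
  then show ?thesis by (simp add: cert_def sum_distrib_left)
qed

lemma cert_tendsto_0: "(\<lambda>m. of_real (ibc m) * cert N (real m - 1 / 2) / lam ^ m) \<longlonglongrightarrow> 0"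
proof -
  have "(\<lambda>m. newton i * (of_real ((real m - 1 / 2 gchoose i) * ibc m) * (1 / lam) ^ m)) \<longlonglongrightarrow> 0" for i
  proof -
    define p :: "real poly" where "p = smult (1 / fact i) (\<Prod>l = 0..<i. [: - 1 / 2 - real l, 1 :])"
    have "poly p (real m) = (real m - 1 / 2 gchoose i)" for m
      by (simp add: p_def gbinomial_prod_rev poly_prod algebra_simps)
    then have "(\<lambda>m. (real m - 1 / 2 gchoose i) * ibc m) \<longlonglongrightarrow> 0"
      using poly_times_ibc_tendsto_0[of 1 p] by simp
    then have "(\<lambda>m. of_real ((real m - 1 / 2 gchoose i) * ibc m) :: complex) \<longlonglongrightarrow> 0"
      by (metis tendsto_of_real of_real_0)
    moreover have "(\<lambda>m. (1 / lam) ^ m) \<longlonglongrightarrow> 0"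
      by (rule LIMSEQ_power_zero) (simp add: norm_divide norm_lam)
    ultimately show ?thesis
      by (intro tendsto_mult_right_zero tendsto_mult_zero)
  qed
  then have "(\<lambda>m. \<Sum>i<N. newton i * (of_real ((real m - 1 / 2 gchoose i) * ibc m) * (1 / lam) ^ m)) \<longlonglongrightarrow> 0"
    by (intro tendsto_null_sum)
  then show ?thesis
    by (simp add: cert_def sum_distrib_left sum_divide_distrib power_divide mult_ac)
qed

text \<open>This is \<open>cert_recurrence\<close> at \<open>x = m + 1 / 2\<close>: there
  \<open>2 * x + 1 = 2 * (m + 1)\<close> and \<open>8 * lam * x = 4 * lam * (2 * m + 1)\<close>,
  which matches the ratio of \<open>ibc (Suc m)\<close> to \<open>ibc m\<close>.\<close>

lemma cert_telescope:
  defines "T \<equiv> \<lambda>N m. of_real (ibc m) * cert N (real m - 1 / 2) / lam ^ m"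
  shows "T N (Suc m) - T N m = of_real (ibc m / (2 * real m + 1)) *
     (1 / 2 - of_nat (2 * N + 1) / 4 * newton N * of_real ((real m + 1 / 2) gchoose N)) / lam ^ Suc m"
proof -
  define b where "b = ibc m / (2 * real m + 1)"
  define X Y where "X = cert N (real m + 1 / 2)" and "Y = cert N (real m - 1 / 2)"
  have b: "ibc m = (2 * real m + 1) * b" "ibc (Suc m) = (real m + 1) / 2 * b"
    by (simp_all add: b_def ibc_Suc field_simps)
  have "of_real (2 * real m + 2) * X - 8 * lam * of_real (real m + 1 / 2) * Y =
      2 - of_nat (2 * N + 1) * newton N * of_real ((real m + 1 / 2) gchoose N)"
    using cert_recurrence[of "real m + 1 / 2" N] by (simp add: X_def Y_def algebra_simps)
  then have *: "1 / 2 - of_nat (2 * N + 1) / 4 * newton N * of_real ((real m + 1 / 2) gchoose N) =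
      of_real ((real m + 1) / 2) * X - lam * of_real (2 * real m + 1) * Y"
    by (simp add: field_simps)
  have "T N (Suc m) - T N m = of_real ((real m + 1) / 2 * b) * X / lam ^ Suc m - of_real ((2 * real m + 1) * b) * Y / lam ^ m"
    unfolding T_def X_def Y_def b by (simp add: algebra_simps)
  also have "\<dots> = of_real b * (of_real ((real m + 1) / 2) * X - lam * of_real (2 * real m + 1) * Y) / lam ^ Suc m"
    by (simp add: divide_simps) (simp add: algebra_simps)
  finally show ?thesis unfolding * b_def .
qed

text \<open>From half of \<open>pi_series\<close> subtract \<open>4 + 2 * \<i>\<close> times the
  telescoping sum, in real parts: the constant \<open>1 / 2\<close> of \<open>cert_telescope\<close>
  cancels and only the terms with \<open>gchoose N\<close> survive. The boundary value
  \<open>- T 0\<close> produces \<open>8 * Z\<close>.\<close>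

lemma pi_remainder_series:
  fixes N :: nat
  defines "E \<equiv> (4 + 2 * \<i>) * (of_nat (2 * N + 1) / 4 * newton N)"
  defines "Z \<equiv> \<Sum>j<N. Re ((1 + \<i> / 2) * kap ^ j) / (2 * real j + 1)"
  shows "(\<lambda>m. Re (E / lam ^ Suc m) * (ibc m / (2 * real m + 1) * ((real m + 1 / 2) gchoose N))) sums (pi / 2 + 8 * Z)"
proof -
  define T where "T = (\<lambda>m. of_real (ibc m) * cert N (real m - 1 / 2) / lam ^ m)"
  have "(\<lambda>m. T (Suc m) - T m) sums (0 - T 0)"
    using cert_tendsto_0[of N] unfolding T_def by (rule telescope_sums)
  from sums_Re[OF sums_mult[OF this, of "4 + 2 * \<i>"]]
  have "(\<lambda>m. Re ((4 + 2 * \<i>) * (T (Suc m) - T m))) sums Re ((4 + 2 * \<i>) * (0 - T 0))" .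
  then have "(\<lambda>m. Re ((4 + 2 * \<i>) / lam ^ Suc m) * (ibc m / (2 * real m + 1)) / 2 - Re ((4 + 2 * \<i>) * (T (Suc m) - T m)))
      sums (pi / 2 - Re ((4 + 2 * \<i>) * (0 - T 0)))"
    by (intro sums_diff sums_divide pi_series)
  moreover have "Re ((4 + 2 * \<i>) / lam ^ Suc m) * (ibc m / (2 * real m + 1)) / 2 - Re ((4 + 2 * \<i>) * (T (Suc m) - T m)) =
      Re (E / lam ^ Suc m) * (ibc m / (2 * real m + 1) * ((real m + 1 / 2) gchoose N))" for m
  proof -
    define b where "b = ibc m / (2 * real m + 1)"
    define g where "g = (real m + 1 / 2) gchoose N"
    define L where "L = 1 / lam ^ Suc m"
    define c where "c = of_nat (2 * N + 1) / 4 * newton N"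
    have L: "z / lam ^ Suc m = z * L" for z by (simp add: L_def)
    have "(4 + 2 * \<i>) * (T (Suc m) - T m) = of_real (b / 2) * ((4 + 2 * \<i>) * L) - of_real (b * g) * (E * L)"
    proof -
      have "T (Suc m) - T m = of_real b * (1 / 2 - c * of_real g) / lam ^ Suc m"
        unfolding T_def b_def c_def g_def by (rule cert_telescope)
      then have "T (Suc m) - T m = of_real b * (1 / 2 - c * of_real g) * L"
        unfolding L .
      then show ?thesis unfolding E_def c_def[symmetric]
        by (simp only:) (simp add: algebra_simps)
    qed
    then have "Re ((4 + 2 * \<i>) * (T (Suc m) - T m)) = b / 2 * Re ((4 + 2 * \<i>) * L) - b * g * Re (E * L)"
      by (simp only: minus_complex.sel Re_complex_of_real Im_complex_of_real times_complex.sel)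
    then show ?thesis unfolding b_def[symmetric] g_def[symmetric]
      by (simp add: L_def)
  qed
  moreover have "Re ((4 + 2 * \<i>) * (0 - T 0)) = - 8 * Z"
  proof -
    have "(4 + 2 * \<i>) * (0 - T 0) = - 8 * (\<Sum>i<N. (1 + \<i> / 2) * kap ^ i / of_real (2 * real i + 1))"
    proof -
      have T0: "T 0 = 2 * (\<Sum>i<N. kap ^ i / of_real (2 * real i + 1))"
        using cert_minus_half[of N] by (simp add: T_def)
      have eq: "(4 + 2 * \<i>) * (0 - 2 * w) = - 8 * ((1 + \<i> / 2) * w)" for w
        by (simp add: algebra_simps)
      show ?thesis unfolding T0 eq by (simp only: sum_distrib_left times_divide_eq_right)
    qed
    also have "Re \<dots> = - 8 * (\<Sum>i<N. Re ((1 + \<i> / 2) * kap ^ i / of_real (2 * real i + 1)))"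
      by simp
    finally show ?thesis unfolding Z_def by (simp only: Re_divide_of_real)
  qed
  ultimately show ?thesis by simp
qed

text \<open>Up to powers of 2, the first \<open>j + 1\<close> numerator factors of the generalized
  binomial are the odd numbers from \<open>2 * u + 1\<close> to \<open>2 * u + 2 * j + 1\<close>,
  exactly the odd denominators on the left relative to \<open>ibc u\<close>. What remains beside
  \<open>ibc u\<close> is a polynomial in \<open>u\<close> of degree \<open>N - 1\<close>.\<close>

lemma ibc_times_gchoose:
  assumes "j < N"
  shows "ibc (u + j) / (2 * real (u + j) + 1) * ((real (u + j) + 1 / 2) gchoose N) =
    ibc u * ((\<Prod>i\<in>{1..j}. real u + real i) * (\<Prod>i\<in>{Suc j..<N}. 2 * real u + 2 * real j + 1 - 2 * real i)
      / (fact N * 2 ^ (N + j)))"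
proof -
  define h where "h = (\<lambda>i. 2 * real u + 2 * real j + 1 - 2 * real i)"
  define P where "P = (\<Prod>i<Suc j. 2 * real u + 2 * real i + 1)"
  define H where "H = (\<Prod>i\<in>{Suc j..<N}. h i)"
  have "(real (u + j) + 1 / 2) gchoose N = (\<Prod>i = 0..<N. h i / 2) / fact N"
    unfolding gbinomial_prod_rev h_def by (simp add: field_simps)
  also have "(\<Prod>i = 0..<N. h i / 2) = (\<Prod>i = 0..<N. h i) / 2 ^ N"
    by (simp add: prod_dividef)
  also have "(\<Prod>i = 0..<N. h i) = (\<Prod>i = 0..<Suc j. h i) * H"
    unfolding H_def using assms by (intro prod.atLeastLessThan_concat[symmetric]) auto
  also have "(\<Prod>i = 0..<Suc j. h i) = P"
    unfolding P_def atLeast0LessThan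
    by (subst prod.nat_diff_reindex[symmetric]) (auto intro!: prod.cong simp: h_def of_nat_diff)
  finally have g: "(real (u + j) + 1 / 2) gchoose N = P * H / (2 ^ N * fact N)" by simp
  have P: "P = (\<Prod>i<j. 2 * real u + 2 * real i + 1) * (2 * real (u + j) + 1)"
    by (simp add: P_def algebra_simps)
  have "ibc (u + j) / (2 * real (u + j) + 1) * P = ibc (u + j) * (\<Prod>i<j. 2 * real u + 2 * real i + 1)"
    unfolding P by (simp add: field_simps)
  also have "\<dots> = ibc u * (\<Prod>i\<in>{1..j}. real u + real i) / 2 ^ j"
    using ibc_add[of u j] by (simp add: field_simps)
  finally have "ibc (u + j) / (2 * real (u + j) + 1) * P * (H / (2 ^ N * fact N)) =
      ibc u * (\<Prod>i\<in>{1..j}. real u + real i) / 2 ^ j * (H / (2 ^ N * fact N))" by simp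
  then show ?thesis unfolding g H_def h_def by (simp add: power_add mult_ac)
qed

subsection \<open>Rationality and degree\<close>

definition gauss_rats :: "complex set" where
  "gauss_rats = {z. Re z \<in> \<rat> \<and> Im z \<in> \<rat>}"

lemma gauss_rats_mult: "w \<in> gauss_rats \<Longrightarrow> z \<in> gauss_rats \<Longrightarrow> w * z \<in> gauss_rats"
  by (auto simp: gauss_rats_def)

lemma gauss_rats_of_real: "x \<in> \<rat> \<Longrightarrow> of_real x \<in> gauss_rats"
  by (auto simp: gauss_rats_def)

lemma gauss_rats_power: "z \<in> gauss_rats \<Longrightarrow> z ^ n \<in> gauss_rats"
  using gauss_rats_of_real[of 1] by (induction n) (auto intro: gauss_rats_mult)

lemma gauss_rats_kap: "kap \<in> gauss_rats"
  by (simp add: gauss_rats_def kap_def lam_def)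

lemma gauss_rats_newton: "newton i \<in> gauss_rats"
proof (induction i)
  case (Suc i)
  have "newton (Suc i) = of_real (- (2 * real (Suc i) / (2 * real i + 3))) * kap * newton i"
    by simp
  also have "\<dots> \<in> gauss_rats"
    by (intro gauss_rats_mult gauss_rats_of_real gauss_rats_kap Suc Rats_divide Rats_mult Rats_add
        Rats_minus_iff[THEN iffD2]) auto
  finally show ?case .
qed (simp add: gauss_rats_def)

lemma gauss_rats_inverse_lam: "1 / lam \<in> gauss_rats"
proof -
  have "1 / lam = Complex (1 / 2) (- 1 / 2)"
    by (simp add: divide_eq_eq) (simp add: lam_def complex_eq_iff)
  then show ?thesis by (simp add: gauss_rats_def)
qed

section \<open>Products of linear polynomials and telescoping series with rational sum\<close>

lemma degree_prod_linear_le: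
  fixes f :: "'a \<Rightarrow> 'b :: comm_semiring_1"
  assumes "finite I"
  shows "degree (\<Prod>i\<in>I. [: f i, c :]) \<le> card I"
proof -
  have "degree (\<Prod>i\<in>I. [: f i, c :]) \<le> sum (degree \<circ> (\<lambda>i. [: f i, c :])) I"
    using assms by (rule degree_prod_sum_le)
  also have "\<dots> \<le> (\<Sum>i\<in>I. 1)" by (intro sum_mono) simp
  finally show ?thesis by simp
qed

lemma coeff_prod_linear:
  fixes f :: "'a \<Rightarrow> 'b :: idom"
  assumes "finite I" "c \<noteq> 0"
  shows "coeff (\<Prod>i\<in>I. [: f i, c :]) (card I) = c ^ card I"
proof -
  have "degree (\<Prod>i\<in>I. [: f i, c :]) = card I"
    using assms by (subst degree_prod_eq_sum_degree) auto
  moreover have "lead_coeff (\<Prod>i\<in>I. [: f i, c :]) = c ^ card I"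
    using assms by (simp add: lead_coeff_prod)
  ultimately show ?thesis by simp
qed

lemma telescoping_poly:
  assumes "k \<ge> 1"
  obtains V :: "rat poly" and c :: rat where
    "degree V \<le> 4 * k" "coeff V (4 * k) \<noteq> 0" "c \<noteq> 0"
    "(\<lambda>n. of_rat (poly V (of_nat n)) * (ibc (4 * k * n) / (-4) ^ (k * n))) sums of_rat c"
proof -
  define N where "N = 4 * k"
  have N: "N \<ge> 1" "N > 0" using assms by (auto simp: N_def)
  \<comment> \<open>By \<open>ibc_add\<close>, \<open>D\<close> at \<open>n + 1\<close> collects the
    odd denominators of the ratio of \<open>t (Suc n)\<close> to \<open>t n\<close>, and
    \<open>M\<close> at \<open>n\<close> the rest. So the terms of \<open>M - D\<close> telescope,
    with sum \<open>- poly D 0\<close>, a product of odd integers up to sign.\<close>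
  define D where "D = (\<Prod>i<N. [: 2 * of_nat i + 1 - 2 * of_nat N, 2 * of_nat N :] :: rat poly)"
  define M where "M = smult (1 / (2 ^ N * (-4) ^ k)) (\<Prod>i\<in>{1..N}. [: of_nat i, of_nat N :] :: rat poly)"
  define t where "t = (\<lambda>n. ibc (N * n) / (-4) ^ (k * n))"
  have D: "of_rat (poly D (of_nat n)) = (\<Prod>i<N. 2 * real (N * n) - 2 * real N + 2 * real i + 1)" for n
    by (simp add: D_def poly_prod of_rat_prod of_rat_add of_rat_diff of_rat_mult algebra_simps)
  have M: "of_rat (poly M (of_nat n)) = (\<Prod>i\<in>{1..N}. real (N * n) + real i) / (2 ^ N * (-4) ^ k)" for n
    by (simp add: M_def poly_prod of_rat_prod of_rat_add of_rat_mult of_rat_divide of_rat_power of_rat_minus algebra_simps)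
  have step: "of_rat (poly D (of_nat (Suc n))) * t (Suc n) = of_rat (poly M (of_nat n)) * t n" for n
  proof -
    have "of_rat (poly D (of_nat (Suc n))) = (\<Prod>i<N. 2 * real (N * n) + 2 * real i + 1)"
      unfolding D by (simp add: algebra_simps)
    moreover have "ibc (N * Suc n) * (2 ^ N * (\<Prod>i<N. 2 * real (N * n) + 2 * real i + 1)) =
        ibc (N * n) * (\<Prod>i\<in>{1..N}. real (N * n) + real i)"
      using ibc_add[of "N * n" N] by (simp add: add.commute)
    ultimately have "of_rat (poly D (of_nat (Suc n))) * ibc (N * Suc n) = ibc (N * n) * (\<Prod>i\<in>{1..N}. real (N * n) + real i) / 2 ^ N"
      by (simp add: field_simps)
    then have "of_rat (poly D (of_nat (Suc n))) * t (Suc n) =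
        ibc (N * n) * (\<Prod>i\<in>{1..N}. real (N * n) + real i) / 2 ^ N / (-4) ^ (k * Suc n)"
      by (simp add: t_def)
    also have "\<dots> = of_rat (poly M (of_nat n)) * t n"
      unfolding M t_def by (simp add: power_add mult_ac)
    finally show ?thesis .
  qed
  define V where "V = M - D"
  have "(\<lambda>n. of_rat (poly D (of_nat n)) * t n) \<longlonglongrightarrow> 0"
  proof (rule Lim_null_comparison)
    define p where "p = (\<Prod>i<N. [: 2 * real i + 1 - 2 * real N, 2 * real N :])"
    have p: "of_rat (poly D (of_nat n)) = poly p (real n)" for n
      unfolding D p_def by (simp add: poly_prod algebra_simps)
    show "(\<lambda>n. \<bar>poly p (real n) * ibc (N * n)\<bar>) \<longlonglongrightarrow> 0"
      by (intro tendsto_rabs_zero poly_times_ibc_tendsto_0 N)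
    have "\<bar>t n\<bar> \<le> \<bar>ibc (N * n)\<bar>" for n
      by (simp add: t_def abs_mult power_abs divide_le_eq mult_left_le mult_le_cancel_left1)
    then show "\<forall>\<^sub>F n in sequentially. norm (of_rat (poly D (of_nat n)) * t n) \<le> \<bar>poly p (real n) * ibc (N * n)\<bar>"
      unfolding p by (intro always_eventually allI) (simp add: abs_mult mult_left_mono)
  qed
  from telescope_sums[OF this]
  have "(\<lambda>n. of_rat (poly V (of_nat n)) * t n) sums (0 - of_rat (poly D (of_nat 0)) * t 0)"
    unfolding step by (simp add: V_def of_rat_diff left_diff_distrib)
  then have "(\<lambda>n. of_rat (poly V (of_nat n)) * t n) sums of_rat (- poly D 0)"
    by (simp add: t_def of_rat_minus)
  moreover have "poly D 0 \<noteq> 0"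
  proof -
    have "2 * of_nat i + 1 - 2 * of_nat N \<noteq> (0 :: rat)" for i
    proof
      assume "2 * of_nat i + 1 - 2 * of_nat N = (0 :: rat)"
      then have "(of_nat (2 * i + 1) :: rat) = of_nat (2 * N)" by simp
      then have "2 * i + 1 = 2 * N" by (simp only: of_nat_eq_iff)
      then show False by presburger
    qed
    then show ?thesis by (simp add: D_def poly_prod)
  qed
  moreover have "degree V \<le> N"
    unfolding V_def D_def M_def
    using degree_prod_linear_le[of "{..<N}"] degree_prod_linear_le[of "{1..N}"]
    by (intro degree_diff_le order.trans[OF degree_smult_le]) auto
  moreover have "coeff V N \<noteq> 0"
  proof
    \<comment> \<open>Equal leading coefficients would force
      \<open>1 = 2 ^ N * 2 ^ N * (-4) ^ k\<close>, impossible by parity.\<close>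
    have "coeff D N = (2 * of_nat N) ^ N"
      using coeff_prod_linear[of "{..<N}" "2 * of_nat N :: rat"] N unfolding D_def by simp
    moreover have "coeff M N = of_nat N ^ N / (2 ^ N * (-4) ^ k)"
      using coeff_prod_linear[of "{1..N}" "of_nat N :: rat"] N unfolding M_def by simp
    moreover assume "coeff V N = 0"
    ultimately have "of_nat N ^ N = (2 * of_nat N) ^ N * (2 ^ N * (-4) ^ k :: rat)"
      by (simp add: V_def field_simps)
    then have "1 = (2 ^ N * 2 ^ N * (-4) ^ k :: rat)"
      using N by (simp add: power_mult_distrib)
    then have "of_int 1 = (of_int (2 ^ N * 2 ^ N * (-4) ^ k) :: rat)"
      by simp
    then have "(1::int) = 2 ^ N * 2 ^ N * (-4) ^ k"
      by (simp only: of_int_eq_iff)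
    then have "even (1::int)"
      using N by (metis dvd_triv_left even_mult_iff even_power even_numeral)
    then show False by simp
  qed
  ultimately show thesis
    by (intro that[of V "- poly D 0"]) (simp_all add: N_def t_def)
qed

section \<open>Grouping into blocks of length \<open>4 * k\<close> and adjusting constant and
  degree\<close>

theorem theorem1:
  fixes k :: nat
  assumes "k \<ge> 1"
  shows "\<exists>S :: rat poly. degree S = 4 * k \<and>
    (\<lambda>n::nat. of_rat (poly S (of_nat n)) /
        (real ((8 * k * n) choose (4 * k * n)) * (-4) ^ (k * n))) sums pi"
proof -
  define N where "N = 4 * k"
  have N: "N \<ge> 1" using assms by (simp add: N_def)
  define t where "t = (\<lambda>n. ibc (N * n) / (-4) ^ (k * n))"
  define E where "E = (4 + 2 * \<i>) * (of_nat (2 * N + 1) / 4 * newton N)"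
  define Z where "Z = (\<Sum>j<N. Re ((1 + \<i> / 2) * kap ^ j) / (2 * real j + 1))"
  have "Z \<noteq> 0" "Z \<in> \<rat>" unfolding Z_def by (rule artanh_partial_sum[OF N])+
  then obtain z :: rat where z: "Z = of_rat z" "z \<noteq> 0" by (auto elim: Rats_cases)
  \<comment> \<open>\<open>E\<close> and \<open>1 / lam\<close> are Gaussian rationals; this is what
    makes the coefficients of \<open>Q j\<close> rational.\<close>
  have "Re (E / lam ^ Suc j) \<in> \<rat>" for j
  proof -
    have "E / lam ^ Suc j = (4 + 2 * \<i>) * (of_real (real (2 * N + 1) / 4) * newton N) * (1 / lam) ^ Suc j"
      by (simp add: E_def power_divide)
    also have "\<dots> \<in> gauss_rats"
      by (intro gauss_rats_mult gauss_rats_newton gauss_rats_power gauss_rats_inverse_lam gauss_rats_of_real Rats_divide)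
        (auto simp: gauss_rats_def)
    finally show ?thesis by (simp add: gauss_rats_def)
  qed
  then have "\<exists>r. Re (E / lam ^ Suc j) = of_rat r" for j
    by (meson Rats_cases)
  then obtain r :: "nat \<Rightarrow> rat" where r: "\<And>j. Re (E / lam ^ Suc j) = of_rat (r j)"
    by metis
  \<comment> \<open>\<open>Q j\<close> is the share of the index \<open>n * N + j\<close> in block
    \<open>n\<close>, read off \<open>ibc_times_gchoose\<close> with \<open>u = n * N\<close>; the
    power \<open>lam ^ (n * N) = (-4) ^ (k * n)\<close> is real and goes into
    \<open>t n\<close>.\<close>
  define Q where "Q = (\<lambda>j. smult (r j / (fact N * 2 ^ (N + j)))
    ((\<Prod>i\<in>{1..j}. [: of_nat i, of_nat N :]) *
     (\<Prod>i\<in>{Suc j..<N}. [: 2 * of_nat j + 1 - 2 * of_nat i, 2 * of_nat N :])) :: rat poly)"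
  define P where "P = (\<Sum>j<N. Q j)"
  have Q: "of_rat (poly (Q j) (of_nat n)) * t n =
      Re (E / lam ^ Suc (n * N + j)) * (ibc (n * N + j) / (2 * real (n * N + j) + 1) * ((real (n * N + j) + 1 / 2) gchoose N))"
    if "j < N" for j n
  proof -
    have "lam ^ (n * N) = of_real ((-4) ^ (k * n))"
    proof -
      have "lam ^ (n * N) = (lam ^ 4) ^ (k * n)" by (simp only: N_def mult_ac flip: power_mult)
      then show ?thesis by (simp add: lam_pow4)
    qed
    then have "E / lam ^ Suc (n * N + j) = E / lam ^ Suc j / of_real ((-4) ^ (k * n))"
      by (simp add: power_add mult_ac)
    then have "Re (E / lam ^ Suc (n * N + j)) = of_rat (r j) / (-4) ^ (k * n)"
      by (simp only: Re_divide_of_real r)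
    moreover have "of_rat (poly (Q j) (of_nat n)) = of_rat (r j) *
      ((\<Prod>i\<in>{1..j}. real (n * N) + real i) * (\<Prod>i\<in>{Suc j..<N}. 2 * real (n * N) + 2 * real j + 1 - 2 * real i)
      / (fact N * 2 ^ (N + j)))"
    proof -
      have "of_rat (fact N) = (fact N :: real)"
        by (metis of_nat_fact of_rat_of_nat_eq)
      then show ?thesis
      by (simp add: Q_def poly_prod of_rat_prod of_rat_add of_rat_diff of_rat_mult of_rat_divide of_rat_power algebra_simps)
    qed
    ultimately show ?thesis unfolding ibc_times_gchoose[OF that] t_def by (simp add: mult_ac)
  qed
  have "degree P \<le> N - 1"
    unfolding P_def
  proof (rule degree_sum_le)
    fix j assume "j \<in> {..<N}"
    then have "j < N" by simp
    have "degree ((\<Prod>i\<in>{1..j}. [: of_nat i, of_nat N :]) *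
     (\<Prod>i\<in>{Suc j..<N}. [: 2 * of_nat j + 1 - 2 * of_nat i, 2 * of_nat N :]) :: rat poly) \<le> card {1..j} + card {Suc j..<N}"
      by (intro order.trans[OF degree_mult_le] add_mono degree_prod_linear_le) auto
    also have "\<dots> = N - 1" using \<open>j < N\<close> by simp
    finally show "degree (Q j) \<le> N - 1"
      unfolding Q_def by (rule order.trans[OF degree_smult_le])
  qed simp
  have "(\<lambda>n. \<Sum>m\<in>{n * N..<n * N + N}. Re (E / lam ^ Suc m) * (ibc m / (2 * real m + 1) * ((real m + 1 / 2) gchoose N)))
      sums (pi / 2 + 8 * Z)"
    using pi_remainder_series[of N] N unfolding E_def Z_def by (intro sums_group) auto
  moreover have "(\<Sum>m\<in>{n * N..<n * N + N}. Re (E / lam ^ Suc m) * (ibc m / (2 * real m + 1) * ((real m + 1 / 2) gchoose N)))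
      = of_rat (poly P (of_nat n)) * t n" for n
  proof -
    have "(\<Sum>m\<in>{n * N..<n * N + N}. f m) = (\<Sum>j<N. f (n * N + j))" for f :: "nat \<Rightarrow> real"
      using sum.shift_bounds_nat_ivl[of f 0 "n * N" N] by (simp add: atLeast0LessThan add.commute)
    then show ?thesis
      by (simp add: P_def poly_sum of_rat_sum sum_distrib_right Q del: power_Suc)
  qed
  ultimately have P: "(\<lambda>n. of_rat (poly P (of_nat n)) * t n) sums (pi / 2 + 8 * Z)" by simp
  obtain V :: "rat poly" and c :: rat where V: "degree V \<le> N" "coeff V N \<noteq> 0" "c \<noteq> 0"
    "(\<lambda>n. of_rat (poly V (of_nat n)) * t n) sums of_rat c"
    unfolding N_def t_def by (rule telescoping_poly[OF assms])
  \<comment> \<open>With \<open>a * c = 16 * Z\<close>, subtracting \<open>a\<close> times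
    \<open>V\<close> removes the constant from twice the series of \<open>P\<close>. As
    \<open>z \<noteq> 0\<close> gives \<open>a \<noteq> 0\<close>, \<open>V\<close> also supplies
    the coefficient of degree \<open>N\<close> that \<open>P\<close> lacks.\<close>
  define a where "a = 16 * z / c"
  define S where "S = smult 2 P - smult a V"
  have "(\<lambda>n. 2 * (of_rat (poly P (of_nat n)) * t n) - of_rat a * (of_rat (poly V (of_nat n)) * t n)) sums
      (2 * (pi / 2 + 8 * Z) - of_rat a * of_rat c)"
    by (intro sums_diff sums_mult P V)
  moreover have "of_rat a * of_rat c = 16 * Z"
    using V(3) by (simp add: a_def z of_rat_divide of_rat_mult)
  ultimately have "(\<lambda>n. of_rat (poly S (of_nat n)) * t n) sums pi"
    by (simp add: S_def of_rat_diff of_rat_mult algebra_simps)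
  moreover have "of_rat (poly S (of_nat n)) * t n = of_rat (poly S (of_nat n)) /
        (real ((8 * k * n) choose (4 * k * n)) * (-4) ^ (k * n))" for n
    by (simp add: t_def ibc_def N_def mult.assoc)
  moreover have "degree S = N"
  proof (rule antisym)
    show "degree S \<le> N"
      unfolding S_def using \<open>degree P \<le> N - 1\<close> V(1)
      by (intro degree_diff_le order.trans[OF degree_smult_le]) auto
    have "coeff P N = 0" using \<open>degree P \<le> N - 1\<close> N by (intro coeff_eq_0) simp
    then have "coeff S N \<noteq> 0" using V(2,3) z by (simp add: S_def a_def)
    then show "N \<le> degree S" by (rule le_degree)
  qed
  ultimately show ?thesis unfolding N_def by auto
qed

end
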